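(* Let $Z_1,\dots,Z_n,Z_{n+1}=(X_{n+1},Y_{n+1})$ be an exchangeable sequence of random variables in $\mathbb{R}^{p+1}$ and let $\tau\sim\mathrm{Unif}[0,1]$ be independent of it. Suppose the split conformity measure $E$ is monotonic and balanced and that the conformal atoms are almost surely distinct. Let $\mu_n(\cdot\mid x_{n+1})$ be the measure induced by the split conformal predictive system, let $\tilde\mu_n(\cdot\mid x_{n+1})$ be its tail-corrected version, and let $Q^{CPD}$ and $\tilde Q^{CPD}$ be the associated randomized predictive distributions (all defined in the context). If $n-m\to\infty$ as $n\to\infty$, then $\tilde Q^{CPD}(\cdot,(X_{n+1},Y_{n+1}),\tau)$ is an asymptotic randomized predictive system. Furthermore, $$\sup_{u\in[0,1]}\left|\mathbb{P}\bigl(\tilde Q^{CPD}(\cdot,(X_{n+1},Y_{n+1}),\tau)\le u\bigr)-u\right|\le\frac{1}{n-m+1}.$$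
   Context: Write $z_i=(x_i,y_i)\in\mathbb{R}^p\times\mathbb{R}$. The first $m<n$ observations $z_1,\dots,z_m$ form the training set and $z_{m+1},\dots,z_n$ the calibration set; $m$ may depend on $n$. It is assumed that $n-m\ge 2$. A split conformity measure is a measurable function $E:(\mathbb{R}^{p+1})^{m+1}\to\mathbb{R}$. It is monotonic if $y\le y'$ implies $E(z_1,\dots,z_m,(x,y))\le E(z_1,\dots,z_m,(x,y'))$ for all $x$. A monotonic $E$ is balanced if for all $z_1,\dots,z_m$ the convex hull of $\{E(z_1,\dots,z_m,(x,y)):y\in\mathbb{R}\}$ is an open interval of $\mathbb{R}$ not depending on $x$. Standing assumption (coercivity): the convex hull of $E(z_1,\dots,z_m,\mathbb{R}^{p+1})$ is $(-\infty,\infty)$. Conformal atoms: for $i=1,\dots,n-m$, $C_i=C_i(x_{n+1})$ is the solution of $E(z_1,\dots,z_m,(x_{m+i},y_{m+i}))=E(z_1,\dots,z_m,(x_{n+1},C_i))$ (assumed to exist); $C_{(1)}\le\dots\le C_{(n-m)}$ are the sorted atoms. Measure of the split conformal predictive system, on $\overline{\mathbb{R}}=[-\infty,\infty]$ (with $\delta$ the Dirac measure): $$\mu_n(\cdot\mid x_{n+1})=\frac{\tau}{n-m+1}\delta_{-\infty}+\sum_{i=1}^{n-m}\frac{1}{n-m+1}\delta_{C_{(i)}(x_{n+1})}+\frac{1-\tau}{n-m+1}\delta_{+\infty}.$$ Tail-corrected measure, on $\mathbb{R}$: $$\tilde\mu_n(\cdot\mid x_{n+1})=\frac{1+\tau}{n-m+1}\delta_{C_{(1)}(x_{n+1})}+\sum_{i=2}^{n-m-1}\frac{1}{n-m+1}\delta_{C_{(i)}(x_{n+1})}+\frac{2-\tau}{n-m+1}\delta_{C_{(n-m)}(x_{n+1})}.$$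 The associated randomized predictive distributions are $$Q^{CPD}(\cdot,(x_{n+1},y),\tau)=\mu_n([-\infty,y)\mid x_{n+1})+\tau\mu_n(\{y\}\mid x_{n+1}),$$ $$\tilde Q^{CPD}(\cdot,(x_{n+1},y),\tau)=\tilde\mu_n((-\infty,y)\mid x_{n+1})+\tau\tilde\mu_n(\{y\}\mid x_{n+1}),$$ where the dot stands for $z_1,\dots,z_n$ (random: $Z_1,\dots,Z_n$). It is part of the setting that $Q^{CPD}$ coincides with the split conformal transducer determined by $E$, namely $$\frac{|\{i:E_i<E^y\}|+\tau|\{i:E_i=E^y\}|+\tau}{n-m+1},$$ with $i=1,\dots,n-m$, $E_i=E(z_1,\dots,z_m,(x_{m+i},y_{m+i}))$ and $E^y=E(z_1,\dots,z_m,(x_{n+1},y))$. Known fact: for exchangeable $Z_1,\dots,Z_{n+1}$ and independent $\tau\sim\mathrm{Unif}[0,1]$, a split conformal transducer evaluated at $(Z_1,\dots,Z_{n+1},\tau)$ is $\mathrm{Unif}[0,1]$. A function $Q:(\mathbb{R}^{p+1})^{n+1}\times[0,1]\to[0,1]$ (understood as a family indexed by $n$) is an asymptotic randomized predictive system if: (1) monotonicity: for fixed $z_1,\dots,z_n,x_{n+1}$, $Q(z_1,\dots,z_n,(x_{n+1},y),\tau)$ is non-decreasing in $y$ for fixed $\tau$ and in $\tau$ for fixed $y$; (2) boundary stability: for all $z_1,\dots,z_n,x_{n+1}$, $\lim_{y\to-\infty}Q(z_1,\dots,z_n,(x_{n+1},y),0)=0$ and $\lim_{y\to\infty}Q(z_1,\dots,z_n,(x_{n+1},y),1)=1$;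 (3) asymptotic validity: for any exchangeable $Z_1,\dots,Z_{n+1}$ and independent $\tau\sim\mathrm{Unif}[0,1]$ (here: satisfying the hypotheses of the statement), $Q(Z_1,\dots,Z_n,Z_{n+1},\tau)$ converges in distribution to $\mathrm{Unif}[0,1]$ as $n\to\infty$. *)

theory Defs
  imports "HOL-Probability.Probability"
begin

text \<open>
  An observation \<open>z = (x, y)\<close> lives in \<open>\<real>\<^sup>p \<times> \<real>\<close>, with \<open>p\<close> the cardinality of the index type.
  A tuple \<open>(z\<^sub>1, \<dots>, z\<^sub>k)\<close> is an element of \<open>extensional {1..k}\<close>, the space of the product
  sigma-algebra \<open>Pi\<^sub>M {1..k} (\<lambda>_. borel)\<close>.
\<close>

type_synonym 'p obs = "(real ^ 'p) \<times> real"


subsection \<open>Split conformity measures\<close>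

definition split_conformity_measure ::
    "nat \<Rightarrow> ((nat \<Rightarrow> 'p::finite obs) \<Rightarrow> 'p obs \<Rightarrow> real) \<Rightarrow> bool" where
  "split_conformity_measure m E \<longleftrightarrow>
     (\<lambda>(w, z). E w z) \<in> borel_measurable (Pi\<^sub>M {1..m} (\<lambda>_. borel) \<Otimes>\<^sub>M borel)"

definition monotonic_conformity ::
    "nat \<Rightarrow> ((nat \<Rightarrow> 'p::finite obs) \<Rightarrow> 'p obs \<Rightarrow> real) \<Rightarrow> bool" where
  "monotonic_conformity m E \<longleftrightarrow>
     (\<forall>w\<in>extensional {1..m}. \<forall>x y y'. y \<le> y' \<longrightarrow> E w (x, y) \<le> E w (x, y'))"

definition balanced_conformity ::
    "nat \<Rightarrow> ((nat \<Rightarrow> 'p::finite obs) \<Rightarrow> 'p obs \<Rightarrow> real) \<Rightarrow> bool" where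
  "balanced_conformity m E \<longleftrightarrow>
     (\<forall>w\<in>extensional {1..m}. \<exists>I. open I \<and> is_interval I \<and>
        (\<forall>x. convex hull (range (\<lambda>y. E w (x, y))) = I))"

definition coercive_conformity ::
    "nat \<Rightarrow> ((nat \<Rightarrow> 'p::finite obs) \<Rightarrow> 'p obs \<Rightarrow> real) \<Rightarrow> bool" where
  "coercive_conformity m E \<longleftrightarrow>
     (\<forall>w\<in>extensional {1..m}. convex hull (range (E w)) = UNIV)"


subsection \<open>Conformal atoms\<close>

definition atom_eq ::
    "nat \<Rightarrow> ((nat \<Rightarrow> 'p::finite obs) \<Rightarrow> 'p obs \<Rightarrow> real) \<Rightarrow> (nat \<Rightarrow> 'p obs) \<Rightarrow> real ^ 'p \<Rightarrow> nat \<Rightarrow> real \<Rightarrow> bool" where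
  "atom_eq m E z x i c \<longleftrightarrow>
     E (restrict z {1..m}) (z (m + i)) = E (restrict z {1..m}) (x, c)"

text \<open>
  Uniqueness is not an extra restriction: if \<open>E\<close> is monotonic and solutions exist, then uniqueness
  holds exactly when the split conformal predictive system coincides with the split conformal
  transducer. One direction is \<open>Q_cpd_eq_split_transducer\<close> below; conversely, two solutions of one
  equation would make every point between them a solution, but there are only finitely many atoms.
\<close>

definition conformal_atoms_exist ::
    "nat \<Rightarrow> nat \<Rightarrow> ((nat \<Rightarrow> 'p::finite obs) \<Rightarrow> 'p obs \<Rightarrow> real) \<Rightarrow> bool" where
  "conformal_atoms_exist m n E \<longleftrightarrow>
     (\<forall>z\<in>extensional {1..n}. \<forall>x. \<forall>i\<in>{1..n - m}. \<exists>!c. atom_eq m E z x i c)"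

definition conformal_atom ::
    "nat \<Rightarrow> ((nat \<Rightarrow> 'p::finite obs) \<Rightarrow> 'p obs \<Rightarrow> real) \<Rightarrow> (nat \<Rightarrow> 'p obs) \<Rightarrow> real ^ 'p \<Rightarrow> nat \<Rightarrow> real" where
  "conformal_atom m E z x i = (THE c. atom_eq m E z x i c)"

definition sorted_atom ::
    "nat \<Rightarrow> nat \<Rightarrow> ((nat \<Rightarrow> 'p::finite obs) \<Rightarrow> 'p obs \<Rightarrow> real) \<Rightarrow> (nat \<Rightarrow> 'p obs) \<Rightarrow> real ^ 'p \<Rightarrow> nat \<Rightarrow> real" where
  "sorted_atom m n E z x i = sort (map (conformal_atom m E z x) [1..<n - m + 1]) ! (i - 1)"


subsection \<open>Predictive measures and randomized predictive distributions\<close>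

text \<open>
  \<open>weighted_diracs I w a\<close> is \<open>\<Sum>i\<in>I. w i \<cdot> \<delta>\<^bsub>a i\<^esub>\<close>, as the image under \<open>a\<close> of the weighted counting
  measure on \<open>I\<close>. Negative weights count as zero; the weights used below are
  non-negative for \<open>\<tau> \<in> [0, 1]\<close>.
\<close>

definition weighted_diracs ::
    "'i set \<Rightarrow> ('i \<Rightarrow> real) \<Rightarrow> ('i \<Rightarrow> 'b::topological_space) \<Rightarrow> 'b measure" where
  "weighted_diracs I w a = distr (point_measure I (\<lambda>i. ennreal (w i))) borel a"

lemma emeasure_weighted_diracs:
  assumes "finite I" "A \<in> sets borel"
  shows "emeasure (weighted_diracs I w a) A =
           (\<Sum>i\<in>I. ennreal (w i) * emeasure (return borel (a i)) A)"
proof -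
  have "emeasure (weighted_diracs I w a) A =
      emeasure (point_measure I (\<lambda>i. ennreal (w i))) (a -` A \<inter> I)"
    unfolding weighted_diracs_def
    by (subst emeasure_distr) (auto simp: assms space_point_measure measurable_point_measure_eq1)
  also have "\<dots> = (\<Sum>i\<in>a -` A \<inter> I. ennreal (w i))"
    using assms by (intro emeasure_point_measure_finite) auto
  also have "\<dots> = (\<Sum>i\<in>I. ennreal (w i) * emeasure (return borel (a i)) A)"
    using assms by (intro sum.mono_neutral_cong_left) (auto simp: indicator_def)
  finally show ?thesis .
qed

lemma measure_weighted_diracs:
  assumes "finite I" "A \<in> sets borel" "\<And>i. i \<in> I \<Longrightarrow> 0 \<le> w i"
  shows "measure (weighted_diracs I w a) A = (\<Sum>i\<in>I. w i * indicator A (a i))"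
proof -
  have "emeasure (weighted_diracs I w a) A = (\<Sum>i\<in>I. ennreal (w i * indicator A (a i)))"
    unfolding emeasure_weighted_diracs[OF assms(1,2)]
    by (intro sum.cong refl) (use assms(2) in \<open>simp split: split_indicator\<close>)
  also have "\<dots> = ennreal (\<Sum>i\<in>I. w i * indicator A (a i))"
    using assms by (intro sum_ennreal) auto
  finally show ?thesis
    using assms(3) by (intro measure_eq_emeasure_eq_ennreal sum_nonneg) auto
qed

definition cpd_measure ::
    "nat \<Rightarrow> nat \<Rightarrow> ((nat \<Rightarrow> 'p::finite obs) \<Rightarrow> 'p obs \<Rightarrow> real) \<Rightarrow> (nat \<Rightarrow> 'p obs) \<Rightarrow> real ^ 'p \<Rightarrow> real \<Rightarrow> ereal measure" where
  "cpd_measure m n E z x \<tau> = weighted_diracs {0..n - m + 1}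
     (\<lambda>i. (if i = 0 then \<tau> else if i = n - m + 1 then 1 - \<tau> else 1) / real (n - m + 1))
     (\<lambda>i. if i = 0 then -\<infinity> else if i = n - m + 1 then \<infinity> else ereal (sorted_atom m n E z x i))"

definition tail_corrected_measure ::
    "nat \<Rightarrow> nat \<Rightarrow> ((nat \<Rightarrow> 'p::finite obs) \<Rightarrow> 'p obs \<Rightarrow> real) \<Rightarrow> (nat \<Rightarrow> 'p obs) \<Rightarrow> real ^ 'p \<Rightarrow> real \<Rightarrow> real measure" where
  "tail_corrected_measure m n E z x \<tau> = weighted_diracs {1..n - m}
     (\<lambda>i. (if i = 1 then 1 + \<tau> else if i = n - m then 2 - \<tau> else 1) / real (n - m + 1))
     (sorted_atom m n E z x)"

text \<open>
  In both functions below \<open>\<tau>\<close> enters twice: through the measure and as the weight of \<open>{y}\<close>.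
\<close>

definition Q_cpd ::
    "nat \<Rightarrow> nat \<Rightarrow> ((nat \<Rightarrow> 'p::finite obs) \<Rightarrow> 'p obs \<Rightarrow> real) \<Rightarrow> (nat \<Rightarrow> 'p obs) \<Rightarrow> 'p obs \<Rightarrow> real \<Rightarrow> real" where
  "Q_cpd m n E z z' \<tau> = (case z' of (x, y) \<Rightarrow>
     measure (cpd_measure m n E z x \<tau>) {-\<infinity>..<ereal y}
     + \<tau> * measure (cpd_measure m n E z x \<tau>) {ereal y})"

definition Q_cpd_tc ::
    "nat \<Rightarrow> nat \<Rightarrow> ((nat \<Rightarrow> 'p::finite obs) \<Rightarrow> 'p obs \<Rightarrow> real) \<Rightarrow> (nat \<Rightarrow> 'p obs) \<Rightarrow> 'p obs \<Rightarrow> real \<Rightarrow> real" where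
  "Q_cpd_tc m n E z z' \<tau> = (case z' of (x, y) \<Rightarrow>
     measure (tail_corrected_measure m n E z x \<tau>) {..<y}
     + \<tau> * measure (tail_corrected_measure m n E z x \<tau>) {y})"

definition split_transducer ::
    "nat \<Rightarrow> nat \<Rightarrow> ((nat \<Rightarrow> 'p::finite obs) \<Rightarrow> 'p obs \<Rightarrow> real) \<Rightarrow> (nat \<Rightarrow> 'p obs) \<Rightarrow> 'p obs \<Rightarrow> real \<Rightarrow> real" where
  "split_transducer m n E z z' \<tau> =
     (let w = restrict z {1..m} in
      (real (card {i\<in>{1..n - m}. E w (z (m + i)) < E w z'})
       + \<tau> * real (card {i\<in>{1..n - m}. E w (z (m + i)) = E w z'}) + \<tau>) / real (n - m + 1))"

lemma sum_sorted_atom: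
  "(\<Sum>i = 1..n - m. f (sorted_atom m n E z x i)) = (\<Sum>i = 1..n - m. f (conformal_atom m E z x i))"
  for f :: "real \<Rightarrow> real"
proof -
  let ?xs = "map (conformal_atom m E z x) [1..<n - m + 1]"
  have "(\<Sum>i = 1..n - m. f (sorted_atom m n E z x i)) = (\<Sum>i<n - m. f (sort ?xs ! i))"
    by (rule sum.reindex_bij_witness[of _ Suc "\<lambda>i. i - 1"]) 
      (auto simp: sorted_atom_def simp del: upt_Suc)
  also have "\<dots> = sum_list (map f (sort ?xs))"
    by (simp add: sum_list_sum_nth atLeast0LessThan del: upt_Suc)
  also have "\<dots> = sum_list (map f ?xs)"
    by (metis mset_map mset_sort sum_mset_sum_list)
  also have "\<dots> = (\<Sum>i = 1..n - m. f (conformal_atom m E z x i))"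
    by (simp add: interv_sum_list_conv_sum_set_nat comp_def atLeastLessThanSuc_atLeastAtMost
        del: upt_Suc)
  finally show ?thesis .
qed

lemma Q_cpd_eq_split_transducer:
  assumes mn: "m < n" and mono: "monotonic_conformity m E" and ex: "conformal_atoms_exist m n E"
    and z: "z \<in> extensional {1..n}" and \<tau>: "\<tau> \<in> {0..1}"
  shows "Q_cpd m n E z z' \<tau> = split_transducer m n E z z' \<tau>"
proof -
  obtain x y where z': "z' = (x, y)" by fastforce
  define N where "N = n - m"
  define w where "w = restrict z {1..m}"
  define C where "C = conformal_atom m E z x"
  have ex1: "\<exists>!c. E w (z (m + i)) = E w (x, c)" if "i \<in> {1..N}" for i
    using ex z that unfolding conformal_atoms_exist_def atom_eq_def N_def w_def by blast
  have C: "E w (z (m + i)) = E w (x, C i)" if "i \<in> {1..N}" for i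
    using theI'[OF ex1[OF that]]
    unfolding C_def conformal_atom_def atom_eq_def w_def by simp
  have mono': "E w (x, a) \<le> E w (x, b)" if "a \<le> b" for a b
    using mono that unfolding monotonic_conformity_def w_def by simp
  have eq: "E w (z (m + i)) = E w (x, y) \<longleftrightarrow> C i = y" if "i \<in> {1..N}" for i
    using ex1[OF that] C[OF that] by metis
  have lt: "E w (z (m + i)) < E w (x, y) \<longleftrightarrow> C i < y" if "i \<in> {1..N}" for i
    using eq[OF that] C[OF that] mono'[of "C i" y] mono'[of y "C i"]
    by (smt (verit))
  define wt where "wt = (\<lambda>i. (if i = 0 then \<tau> else if i = n - m + 1 then 1 - \<tau> else 1) / real (n - m + 1))"
  define atm where "atm = (\<lambda>i. if i = 0 then -\<infinity> else if i = n - m + 1 then \<infinity> else ereal (sorted_atom m n E z x i))"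
  have mu: "measure (cpd_measure m n E z x \<tau>) A = (\<Sum>i\<in>{0..N + 1}. wt i * indicator A (atm i))"
    if "A \<in> sets borel" for A
    unfolding cpd_measure_def wt_def atm_def N_def
    using \<tau> that by (subst measure_weighted_diracs) auto
  have split: "(\<Sum>i\<in>{0..N + 1}. g i) = g 0 + (\<Sum>i = 1..N. g i) + g (N + 1)" for g :: "nat \<Rightarrow> real"
    by (simp add: sum.atLeast_Suc_atMost)
  have card: "(\<Sum>i = 1..N. of_bool (P i)) = real (card {i\<in>{1..N}. P i})" for P
    by (simp add: sum.If_cases Int_def)
  have "measure (cpd_measure m n E z x \<tau>) {-\<infinity>..<ereal y} =
      (\<tau> + (\<Sum>i = 1..N. of_bool (sorted_atom m n E z x i < y))) / real (N + 1)"
    by (subst mu, simp, subst split)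
      (auto simp: wt_def atm_def N_def indicator_def add_divide_distrib sum_divide_distrib
        simp del: sum_of_bool_eq intro!: sum.cong)
  also have "\<dots> = (\<tau> + (\<Sum>i = 1..N. of_bool (C i < y))) / real (N + 1)"
    using sum_sorted_atom[of "\<lambda>c. of_bool (c < y)"] by (simp add: C_def N_def)
  finally have 1: "measure (cpd_measure m n E z x \<tau>) {-\<infinity>..<ereal y} =
      (\<tau> + real (card {i\<in>{1..N}. C i < y})) / real (N + 1)"
    unfolding card .
  have "measure (cpd_measure m n E z x \<tau>) {ereal y} =
      (\<Sum>i = 1..N. of_bool (sorted_atom m n E z x i = y)) / real (N + 1)"
    by (subst mu, simp, subst split)
      (auto simp: wt_def atm_def N_def indicator_def sum_divide_distrib
        simp del: sum_of_bool_eq intro!: sum.cong)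
  also have "\<dots> = (\<Sum>i = 1..N. of_bool (C i = y)) / real (N + 1)"
    using sum_sorted_atom[of "\<lambda>c. of_bool (c = y)"] by (simp add: C_def N_def)
  finally have 2: "measure (cpd_measure m n E z x \<tau>) {ereal y} =
      real (card {i\<in>{1..N}. C i = y}) / real (N + 1)"
    unfolding card .
  have "{i\<in>{1..N}. E w (z (m + i)) < E w (x, y)} = {i\<in>{1..N}. C i < y}"
    "{i\<in>{1..N}. E w (z (m + i)) = E w (x, y)} = {i\<in>{1..N}. C i = y}"
    using lt eq by blast+
  then show ?thesis
    unfolding Q_cpd_def split_transducer_def z' prod.case Let_def 1 2
      N_def[symmetric] w_def[symmetric]
    by (simp add: add_divide_distrib)
qed


subsection \<open>Random data\<close>

definition exchangeable :: "'a measure \<Rightarrow> 'i set \<Rightarrow> 'b measure \<Rightarrow> ('i \<Rightarrow> 'a \<Rightarrow> 'b) \<Rightarrow> bool" where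
  "exchangeable M I N Z \<longleftrightarrow>
     (\<forall>i\<in>I. Z i \<in> M \<rightarrow>\<^sub>M N) \<and>
     (\<forall>\<pi>. \<pi> permutes I \<longrightarrow>
        distr M (Pi\<^sub>M I (\<lambda>_. N)) (\<lambda>\<omega>. \<lambda>i\<in>I. Z (\<pi> i) \<omega>) =
        distr M (Pi\<^sub>M I (\<lambda>_. N)) (\<lambda>\<omega>. \<lambda>i\<in>I. Z i \<omega>))"

text \<open>
  Independence is stated for the generated sigma-algebras because \<open>indep_var\<close> only relates
  random variables with values in the same type.
\<close>

definition exchangeable_data ::
    "nat \<Rightarrow> 'a measure \<Rightarrow> (nat \<Rightarrow> 'a \<Rightarrow> 'p::finite obs) \<Rightarrow> ('a \<Rightarrow> real) \<Rightarrow> bool" where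
  "exchangeable_data n M Z \<tau> \<longleftrightarrow>
     prob_space M \<and>
     exchangeable M {1..n + 1} borel Z \<and>
     \<tau> \<in> borel_measurable M \<and>
     distr M borel \<tau> = uniform_measure lborel {0..1} \<and>
     prob_space.indep_set M
       (sets (vimage_algebra (space M) (\<lambda>\<omega>. \<lambda>i\<in>{1..n + 1}. Z i \<omega>) (Pi\<^sub>M {1..n + 1} (\<lambda>_. borel))))
       (sets (vimage_algebra (space M) \<tau> borel))"

definition eval_at_data ::
    "((nat \<Rightarrow> 'p::finite obs) \<Rightarrow> 'p obs \<Rightarrow> real \<Rightarrow> real) \<Rightarrow>
     nat \<Rightarrow> (nat \<Rightarrow> 'a \<Rightarrow> 'p obs) \<Rightarrow> ('a \<Rightarrow> real) \<Rightarrow> 'a \<Rightarrow> real" where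
  "eval_at_data Q n Z \<tau> \<omega> = Q (\<lambda>i\<in>{1..n}. Z i \<omega>) (Z (n + 1) \<omega>) (\<tau> \<omega>)"

definition atoms_as_distinct ::
    "nat \<Rightarrow> nat \<Rightarrow> ((nat \<Rightarrow> 'p::finite obs) \<Rightarrow> 'p obs \<Rightarrow> real) \<Rightarrow> 'a measure \<Rightarrow> (nat \<Rightarrow> 'a \<Rightarrow> 'p obs) \<Rightarrow> bool" where
  "atoms_as_distinct m n E M Z \<longleftrightarrow>
     (AE \<omega> in M. inj_on (conformal_atom m E (\<lambda>i\<in>{1..n}. Z i \<omega>) (fst (Z (n + 1) \<omega>))) {1..n - m})"


subsection \<open>Asymptotic randomized predictive systems\<close>

text \<open>
  The family \<open>Q\<close> is indexed by \<open>n \<ge> n0\<close>. The data form a triangular array: every \<open>n\<close> may come with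
  its own probability space and its own \<open>Z\<^sub>1, \<dots>, Z\<^bsub>n+1\<^esub>, \<tau>\<close>; \<open>adm\<close> collects further hypotheses
  on the data under which validity is claimed.
\<close>

definition asymptotic_rps ::
    "nat \<Rightarrow> (nat \<Rightarrow> 'a measure \<Rightarrow> (nat \<Rightarrow> 'a \<Rightarrow> 'p::finite obs) \<Rightarrow> bool) \<Rightarrow>
     (nat \<Rightarrow> (nat \<Rightarrow> 'p obs) \<Rightarrow> 'p obs \<Rightarrow> real \<Rightarrow> real) \<Rightarrow> bool" where
  "asymptotic_rps n0 adm Q \<longleftrightarrow>
     (\<forall>n\<ge>n0. \<forall>z\<in>extensional {1..n}. \<forall>x.
        (\<forall>y. \<forall>\<tau>\<in>{0..1}. Q n z (x, y) \<tau> \<in> {0..1}) \<and>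
        (\<forall>\<tau>\<in>{0..1}. mono (\<lambda>y. Q n z (x, y) \<tau>)) \<and>
        (\<forall>y. mono_on {0..1} (\<lambda>\<tau>. Q n z (x, y) \<tau>)) \<and>
        ((\<lambda>y. Q n z (x, y) 0) \<longlongrightarrow> 0) at_bot \<and>
        ((\<lambda>y. Q n z (x, y) 1) \<longlongrightarrow> 1) at_top) \<and>
     (\<forall>M Z \<tau>.
        (\<forall>n\<ge>n0. exchangeable_data n (M n) (Z n) (\<tau> n) \<and> adm n (M n) (Z n)) \<longrightarrow>
        weak_conv_m (\<lambda>n. distr (M n) borel (eval_at_data (Q n) n (Z n) (\<tau> n)))
          (uniform_measure lborel {0..1}))"

end

theory Submission
  imports Defs
begin

text \<open>
  Write \<open>N = n - m\<close>. For \<open>\<tau> \<in> [0, 1]\<close>, let \<open>s\<^sub>i \<in> [0, 1]\<close> be the randomized step of the sorted atom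
  \<open>C\<^sub>i\<close> at \<open>y\<close>. Moving the two tail masses onto the extreme atoms changes the split conformal
  transducer by \<open>(\<tau> s\<^sub>1 + (1 - \<tau>) s\<^sub>N - \<tau>) / (N + 1)\<close>, which lies between \<open>-1 / (N + 1)\<close> and
  \<open>1 / (N + 1)\<close>. The transducer is exactly uniform, so the distribution function of the
  tail-corrected system is within \<open>1 / (N + 1)\<close> of the uniform one.

  For the uniformity, exchangeability lets each of the last \<open>N + 1\<close> observations play the role of the
  test point. Averaging over this choice for fixed data, the values of the transducer sweep, as
  \<open>\<tau>\<close> runs through \<open>[0, 1]\<close>, intervals of lengths \<open>M / (N + 1)\<close> (\<open>M\<close> the multiplicity of a score)
  which tile \<open>[0, 1]\<close>.
\<close>

section \<open>Sorted atoms and counts\<close>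

lemma sum_of_bool_eq_card:
  "finite A \<Longrightarrow> (\<Sum>i\<in>A. of_bool (P i)) = real (card {i\<in>A. P i})"
  by (simp add: Int_def)

text \<open>The elements satisfying a downward closed \<open>P\<close> form an initial segment of a
  sorted list, and \<open>filter\<close> measures its length.\<close>

lemma sorted_nth_iff_less_length_filter:
  fixes xs :: "'a::linorder list"
  assumes "sorted xs" "k < length xs" and down: "\<And>a b. a \<le> b \<Longrightarrow> P b \<Longrightarrow> P a"
  shows "P (xs ! k) \<longleftrightarrow> k < length (filter P xs)"
  using assms(1,2)
proof (induction xs arbitrary: k)
  case (Cons a xs)
  have "filter P xs = []" if "\<not> P a"
    using Cons.prems(1) that down[of a] by (auto simp: filter_empty_conv)
  moreover have "\<not> P (xs ! j)" if "\<not> P a" "j < length xs" for j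
    using Cons.prems(1) that down[of a "xs ! j"] by auto
  ultimately show ?case
    using Cons by (cases k) auto
qed simp

text \<open>Sorting does not change how many atoms satisfy \<open>P\<close>. Counts replace order
  statistics in the measurability proof.\<close>

lemma sorted_atom_iff:
  assumes "i \<in> {1..n - m}" and down: "\<And>a b. a \<le> b \<Longrightarrow> P b \<Longrightarrow> P a"
  shows "P (sorted_atom m n E z x i) \<longleftrightarrow> i \<le> card {j\<in>{1..n - m}. P (conformal_atom m E z x j)}"
proof -
  let ?ys = "map (conformal_atom m E z x) [1..<n - m + 1]"
  have "length (filter P (sort ?ys)) = length (filter P ?ys)"
    by (metis mset_filter mset_sort size_mset)
  also have "\<dots> = length (filter (P \<circ> conformal_atom m E z x) [1..<n - m + 1])"
    by (simp add: filter_map del: upt_Suc)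
  also have "\<dots> = card {j\<in>{1..n - m}. P (conformal_atom m E z x j)}"
    by (subst distinct_card[symmetric]) (auto intro!: arg_cong[where f = card] simp del: upt_Suc)
  finally have len: "length (filter P (sort ?ys)) = card {j\<in>{1..n - m}. P (conformal_atom m E z x j)}" .
  have "P (sort ?ys ! (i - 1)) \<longleftrightarrow> i - 1 < length (filter P (sort ?ys))"
    using assms by (intro sorted_nth_iff_less_length_filter) (auto simp del: upt_Suc)
  \<comment> \<open>List positions start at 0 and atoms at 1; as \<open>i \<ge> 1\<close>,
    \<open>i - 1 < k\<close> means \<open>i \<le> k\<close>.\<close>
  then show ?thesis
    using assms(1) unfolding sorted_atom_def len by auto
qed

lemma sorted_atom_mono:
  assumes "1 \<le> i" "i \<le> j" "j \<le> n - m"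
  shows "sorted_atom m n E z x i \<le> sorted_atom m n E z x j"
  unfolding sorted_atom_def using assms
  by (intro sorted_nth_mono) (auto simp del: upt_Suc)

text \<open>The score at \<open>(x, y)\<close> is monotone in \<open>y\<close>, and by uniqueness it
  meets the score of observation \<open>m + i\<close> only at the atom. Hence comparing the atom
  with \<open>y\<close> amounts to comparing scores, also for strict inequalities.\<close>

lemma conformal_atom_iff:
  fixes E :: "(nat \<Rightarrow> 'p::finite obs) \<Rightarrow> 'p obs \<Rightarrow> real"
  assumes mono: "monotonic_conformity m E" and ex: "conformal_atoms_exist m n E"
    and z: "z \<in> extensional {1..n}" and i: "i \<in> {1..n - m}"
  shows "conformal_atom m E z x i < y \<longleftrightarrow>
           E (restrict z {1..m}) (z (m + i)) < E (restrict z {1..m}) (x, y)"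
    and "conformal_atom m E z x i = y \<longleftrightarrow>
           E (restrict z {1..m}) (z (m + i)) = E (restrict z {1..m}) (x, y)"
proof -
  let ?w = "restrict z {1..m}" and ?C = "conformal_atom m E z x i"
  have ex1: "\<exists>!c. E ?w (z (m + i)) = E ?w (x, c)"
    using ex z i unfolding conformal_atoms_exist_def atom_eq_def by blast
  have C: "E ?w (z (m + i)) = E ?w (x, ?C)"
    using theI'[OF ex1] unfolding conformal_atom_def atom_eq_def by simp
  have mono': "E ?w (x, a) \<le> E ?w (x, b)" if "a \<le> b" for a b
    using mono that unfolding monotonic_conformity_def by simp
  show eq: "?C = y \<longleftrightarrow> E ?w (z (m + i)) = E ?w (x, y)"
    using ex1 C by metis
  show "?C < y \<longleftrightarrow> E ?w (z (m + i)) < E ?w (x, y)"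
    using eq C mono'[of ?C y] mono'[of y ?C] by (smt (verit))
qed

section \<open>Closed forms of the two systems\<close>

text \<open>For \<open>t\<close> in [0, 1] this is the randomized distribution function at
  \<open>y\<close> of a unit mass at \<open>c\<close>.\<close>

definition randomized_step :: "real \<Rightarrow> real \<Rightarrow> real \<Rightarrow> real" where
  "randomized_step t y c = of_bool (c < y) + t * of_bool (c = y)"

lemma randomized_step_bounds:
  assumes "t \<in> {0..1}"
  shows "0 \<le> randomized_step t y c" "randomized_step t y c \<le> 1"
  using assms by (auto simp: randomized_step_def)

lemma randomized_step_mono:
  assumes "t \<in> {0..1}" "y \<le> y'"
  shows "randomized_step t y c \<le> randomized_step t y' c"
  using assms by (auto simp: randomized_step_def)

text \<open>
  The truncation \<open>max 0\<close> makes this valid for all \<open>t\<close>: the variable \<open>\<tau>\<close> may leave \<open>[0, 1]\<close> on a null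
  set, on which measurability still matters because \<open>M\<close> is not assumed complete.
\<close>

lemma Q_cpd_tc_eq_sum:
  "Q_cpd_tc m n E z (x, y) t =
     (\<Sum>i = 1..n - m. max 0 ((if i = 1 then 1 + t else if i = n - m then 2 - t else 1) / real (n - m + 1))
        * randomized_step t y (sorted_atom m n E z x i))"
proof -
  let ?wt = "\<lambda>i. (if i = 1 then 1 + t else if i = n - m then 2 - t else 1) / real (n - m + 1)"
  have "tail_corrected_measure m n E z x t =
      weighted_diracs {1..n - m} (\<lambda>i. max 0 (?wt i)) (sorted_atom m n E z x)"
    unfolding tail_corrected_measure_def weighted_diracs_def by (simp add: ennreal_max_0 max.commute)
  then have mu: "measure (tail_corrected_measure m n E z x t) A =
      (\<Sum>i = 1..n - m. max 0 (?wt i) * indicator A (sorted_atom m n E z x i))"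
    if "A \<in> sets borel" for A
    using that by (simp add: measure_weighted_diracs)
  show ?thesis
    unfolding Q_cpd_tc_def prod.case mu[OF lessThan_borel] mu[OF borel_singleton[OF sets.empty_sets]]
      sum_distrib_left sum.distrib[symmetric]
    by (intro sum.cong refl) (simp add: randomized_step_def indicator_def algebra_simps)
qed

text \<open>Since \<open>2 - t = 1 + (1 - t)\<close>, every atom carries a unit weight, and the
  first and last carry an excess of \<open>t\<close> and \<open>1 - t\<close>. These are different
  indices because \<open>n - m \<ge> 2\<close>.\<close>

lemma Q_cpd_tc_eq:
  assumes N: "m + 2 \<le> n" and t: "t \<in> {0..1}"
  shows "Q_cpd_tc m n E z (x, y) t =
     ((\<Sum>i = 1..n - m. randomized_step t y (sorted_atom m n E z x i))
       + t * randomized_step t y (sorted_atom m n E z x 1)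
       + (1 - t) * randomized_step t y (sorted_atom m n E z x (n - m))) / real (n - m + 1)"
proof -
  let ?s = "\<lambda>i. randomized_step t y (sorted_atom m n E z x i)"
  have nonneg: "max 0 ((if i = 1 then 1 + t else if i = n - m then 2 - t else 1) / real (n - m + 1)) =
      (if i = 1 then 1 + t else if i = n - m then 2 - t else 1) / real (n - m + 1)" for i
    using t by (intro max_absorb2 divide_nonneg_nonneg) auto
  have "Q_cpd_tc m n E z (x, y) t = (\<Sum>i = 1..n - m. (?s i + (if i = 1 then t * ?s 1 else 0)
      + (if i = n - m then (1 - t) * ?s (n - m) else 0)) / real (n - m + 1))"
    unfolding Q_cpd_tc_eq_sum nonneg sum_divide_distrib using N
    by (intro sum.cong refl) (auto simp: algebra_simps simp del: of_nat_add intro!: arg_cong2[where f = divide])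
  then show ?thesis
    using N by (simp add: sum.distrib flip: sum_divide_distrib)
qed

text \<open>Brings the transducer into the form of the tail-corrected system: score comparisons
  become atom comparisons, and the sum over all atoms may be taken in sorted order.\<close>

lemma split_transducer_eq:
  assumes "monotonic_conformity m E" "conformal_atoms_exist m n E" "z \<in> extensional {1..n}"
  shows "split_transducer m n E z (x, y) t =
     ((\<Sum>i = 1..n - m. randomized_step t y (sorted_atom m n E z x i)) + t) / real (n - m + 1)"
proof -
  have "(\<Sum>i = 1..n - m. randomized_step t y (sorted_atom m n E z x i)) =
      (\<Sum>i = 1..n - m. randomized_step t y (conformal_atom m E z x i))"
    by (rule sum_sorted_atom)
  also have "\<dots> = (\<Sum>i = 1..n - m.
      of_bool (E (restrict z {1..m}) (z (m + i)) < E (restrict z {1..m}) (x, y)) +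
      t * of_bool (E (restrict z {1..m}) (z (m + i)) = E (restrict z {1..m}) (x, y)))"
    unfolding randomized_step_def
    by (intro sum.cong refl) (simp add: conformal_atom_iff[OF assms])
  finally show ?thesis
    unfolding split_transducer_def Let_def sum.distrib sum_distrib_left[symmetric]
    by (simp add: sum_of_bool_eq_card del: sum_of_bool_eq)
qed

lemma Q_cpd_tc_close_to_split_transducer:
  assumes "m + 2 \<le> n" "monotonic_conformity m E" "conformal_atoms_exist m n E"
    "z \<in> extensional {1..n}" and t: "t \<in> {0..1}"
  shows "\<bar>Q_cpd_tc m n E z z' t - split_transducer m n E z z' t\<bar> \<le> 1 / real (n - m + 1)"
proof -
  obtain x y where z': "z' = (x, y)" by fastforce
  let ?s = "\<lambda>i. randomized_step t y (sorted_atom m n E z x i)"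
  have "0 \<le> t * ?s 1" "t * ?s 1 \<le> t" "0 \<le> (1 - t) * ?s (n - m)" "(1 - t) * ?s (n - m) \<le> 1 - t"
    using t randomized_step_bounds[OF t] by (auto intro!: mult_nonneg_nonneg mult_left_le)
  \<comment> \<open>The first excess minus \<open>t\<close> lies in [-t, 0] and the second excess in
    [0, 1 - t], so the total lies in [-t, 1 - t].\<close>
  then have "\<bar>t * ?s 1 + (1 - t) * ?s (n - m) - t\<bar> \<le> 1"
    using t by auto
  moreover have "Q_cpd_tc m n E z z' t - split_transducer m n E z z' t =
      (t * ?s 1 + (1 - t) * ?s (n - m) - t) / real (n - m + 1)"
    unfolding z' Q_cpd_tc_eq[OF assms(1) t] split_transducer_eq[OF assms(2-4)]
    by (simp add: diff_divide_distrib add_divide_distrib)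
  ultimately show ?thesis
    by (simp add: divide_right_mono)
qed

section \<open>Monotonicity, range and boundary limits\<close>

lemma Q_cpd_tc_mono:
  assumes "m + 2 \<le> n" "t \<in> {0..1}"
  shows "mono (\<lambda>y. Q_cpd_tc m n E z (x, y) t)"
  using assms
  by (intro monoI)
    (auto simp: Q_cpd_tc_eq simp del: of_nat_add
      intro!: divide_right_mono add_mono sum_mono mult_left_mono randomized_step_mono)

text \<open>No termwise argument works, as the weight \<open>2 - t\<close> of the last atom
  decreases in \<open>t\<close>. The two extreme atoms are therefore treated together in
  \<open>f\<close>; each remaining term is non-decreasing.\<close>

lemma Q_cpd_tc_mono_tau:
  assumes N: "m + 2 \<le> n"
  shows "mono_on {0..1} (\<lambda>t. Q_cpd_tc m n E z (x, y) t)"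
proof (rule mono_onI)
  fix r t :: real assume rt: "r \<in> {0..1}" "t \<in> {0..1}" "r \<le> t"
  let ?c = "sorted_atom m n E z x"
  let ?s = "\<lambda>t i. randomized_step t y (?c i)"
  define f where "f t = t * ?s t 1 + (1 - t) * ?s t (n - m) + (?s t 1 + ?s t (n - m))" for t
  have split: "(\<Sum>i = 1..n - m. g i) = g 1 + g (n - m) + (\<Sum>i = 2..<n - m. g i)" for g :: "nat \<Rightarrow> real"
  proof -
    have "{1..n - m} = insert 1 (insert (n - m) {2..<n - m})" using N by auto
    then show ?thesis using N by simp
  qed
  \<comment> \<open>Quadratic terms remain in two cases: if \<open>y\<close> is the first atom only,
    \<open>f t\<close> is \<open>t + t * t\<close>; if \<open>y\<close> is the last atom only, it is
    \<open>1 + 3 * t - t * t\<close>.\<close>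
  have *: "r * r \<le> t * t" "r * (1 - r) + 2 * r \<le> t * (1 - t) + 2 * t"
  proof -
    show "r * r \<le> t * t" using rt by (intro mult_mono) auto
    have "0 \<le> (t - r) * (3 - t - r)" using rt by (intro mult_nonneg_nonneg) auto
    then show "r * (1 - r) + 2 * r \<le> t * (1 - t) + 2 * t" by (simp add: algebra_simps)
  qed
  \<comment> \<open>Excludes the last atom below \<open>y\<close> with the first above it, where
    \<open>f t = 2 - t\<close> would decrease.\<close>
  have "?c 1 \<le> ?c (n - m)" using N by (intro sorted_atom_mono) auto
  then have "f r \<le> f t"
    unfolding f_def randomized_step_def using rt *
    by (cases "?c 1" y rule: linorder_cases; cases "?c (n - m)" y rule: linorder_cases)
       (auto simp: algebra_simps)
  moreover have "(\<Sum>i = 2..<n - m. ?s r i) \<le> (\<Sum>i = 2..<n - m. ?s t i)"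
    using rt by (intro sum_mono) (auto simp: randomized_step_def)
  ultimately show "Q_cpd_tc m n E z (x, y) r \<le> Q_cpd_tc m n E z (x, y) t"
    unfolding Q_cpd_tc_eq[OF N rt(1)] Q_cpd_tc_eq[OF N rt(2)] split f_def
    by (intro divide_right_mono) auto
qed

text \<open>Each step is at most 1, so the numerator is at most
  \<open>(n - m) + t + (1 - t)\<close>, which is the denominator.\<close>

lemma Q_cpd_tc_bounds:
  assumes N: "m + 2 \<le> n" and t: "t \<in> {0..1}"
  shows "Q_cpd_tc m n E z z' t \<in> {0..1}"
proof -
  obtain x y where z': "z' = (x, y)" by fastforce
  let ?s = "\<lambda>i. randomized_step t y (sorted_atom m n E z x i)"
  have "0 \<le> t * ?s 1" "t * ?s 1 \<le> t" "0 \<le> (1 - t) * ?s (n - m)" "(1 - t) * ?s (n - m) \<le> 1 - t"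
    using t randomized_step_bounds[OF t] by (auto intro!: mult_nonneg_nonneg mult_left_le)
  moreover have "0 \<le> (\<Sum>i = 1..n - m. ?s i)" "(\<Sum>i = 1..n - m. ?s i) \<le> (\<Sum>i = 1..n - m. 1)"
    using randomized_step_bounds[OF t] by (auto intro!: sum_nonneg sum_mono simp del: sum_constant)
  ultimately show ?thesis
    unfolding z' Q_cpd_tc_eq[OF N t] by (simp add: divide_simps del: of_nat_diff)
qed

lemma Q_cpd_tc_at_bot:
  assumes N: "m + 2 \<le> n"
  shows "((\<lambda>y. Q_cpd_tc m n E z (x, y) 0) \<longlongrightarrow> 0) at_bot"
proof (rule tendsto_eventually)
  show "eventually (\<lambda>y. Q_cpd_tc m n E z (x, y) 0 = 0) at_bot"
    using eventually_gt_at_bot[of "sorted_atom m n E z x 1"]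
  proof eventually_elim
    case (elim y)
    have "randomized_step 0 y (sorted_atom m n E z x i) = 0" if "i \<in> {1..n - m}" for i
      using sorted_atom_mono[of 1 i n m E z x] elim that by (auto simp: randomized_step_def)
    then show ?case using N by (subst Q_cpd_tc_eq) auto
  qed
qed

text \<open>Above the last atom every step is 1, and the excess at the first atom raises the
  numerator from \<open>n - m\<close> to \<open>n - m + 1\<close>.\<close>

lemma Q_cpd_tc_at_top:
  assumes N: "m + 2 \<le> n"
  shows "((\<lambda>y. Q_cpd_tc m n E z (x, y) 1) \<longlongrightarrow> 1) at_top"
proof (rule tendsto_eventually)
  show "eventually (\<lambda>y. Q_cpd_tc m n E z (x, y) 1 = 1) at_top"
    using eventually_gt_at_top[of "sorted_atom m n E z x (n - m)"]
  proof eventually_elim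
    case (elim y)
    have "randomized_step 1 y (sorted_atom m n E z x i) = 1" if "i \<in> {1..n - m}" for i
      using sorted_atom_mono[of i "n - m" n m E z x] elim that by (auto simp: randomized_step_def)
    then show ?case using N by (subst Q_cpd_tc_eq) (auto simp: divide_simps)
  qed
qed

section \<open>Tiling of the unit interval by ranks\<close>

text \<open>Each value \<open>v\<close> contributes the increment of \<open>h\<close> across the
  block of ranks that it occupies, and adjacent blocks share an endpoint. The induction adds a new
  maximum, whose block runs from the previous total count to the new one.\<close>

lemma sum_rank_increments_telescope:
  fixes e :: "'i \<Rightarrow> 'b::linorder" and h :: "nat \<Rightarrow> real"
  assumes "finite I" "finite A"
  shows "(\<Sum>v\<in>A. h (card {i\<in>I. e i \<in> A \<and> e i \<le> v}) - h (card {i\<in>I. e i \<in> A \<and> e i < v})) =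
    h (card {i\<in>I. e i \<in> A}) - h 0"
  using assms(2)
proof (induction A rule: finite_linorder_max_induct)
  case (insert b A)
  have "{i\<in>I. e i \<in> insert b A \<and> e i \<le> b} = {i\<in>I. e i \<in> insert b A}"
    "{i\<in>I. e i \<in> insert b A \<and> e i < b} = {i\<in>I. e i \<in> A}"
    using insert.hyps(2) by auto
  moreover have "{i\<in>I. e i \<in> insert b A \<and> e i \<le> v} = {i\<in>I. e i \<in> A \<and> e i \<le> v}"
    "{i\<in>I. e i \<in> insert b A \<and> e i < v} = {i\<in>I. e i \<in> A \<and> e i < v}" if "v \<in> A" for v
    using insert.hyps(2) that by (auto dest: leD)
  moreover have "b \<notin> A" using insert.hyps(2) by auto
  ultimately show ?case
    using insert by simp
qed simp

text \<open>The distribution function of the uniform distribution on [0, 1].\<close>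

definition clamp01 :: "real \<Rightarrow> real" where
  "clamp01 u = max 0 (min 1 u)"

lemma clamp01_nonneg: "0 \<le> clamp01 u"
  by (simp add: clamp01_def)

lemma mult_clamp01_divide: "0 < c \<Longrightarrow> c * clamp01 (x / c) = max 0 (min c x)"
  by (auto simp: clamp01_def max_def min_def field_simps)

text \<open>Put N = \<open>card I\<close>. An index with \<open>L\<close> scores below and
  \<open>K\<close> equal to its own owns the interval [L / N, (L + K) / N], and its summand is the
  fraction of it that lies below \<open>u\<close>. The \<open>K\<close> indices sharing it add up to
  N times the length of that part, and the intervals of distinct scores tile [0, 1].\<close>

lemma sum_clamp_ranks:
  fixes e :: "'i \<Rightarrow> 'b::linorder" and u :: real
  assumes I: "finite I" "I \<noteq> {}"
  shows "(\<Sum>j\<in>I. clamp01 ((u * card I - card {i\<in>I. e i < e j}) / card {i\<in>I. e i = e j})) =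
    card I * clamp01 u"
proof -
  \<comment> \<open>For nonnegative \<open>u\<close>, \<open>h k\<close> is the length of the part
    of [0, k] below \<open>u * card I\<close>; for negative \<open>u\<close> it is 0.\<close>
  define h where "h k = max 0 (min (u * card I) (real k))" for k :: nat
  define L where "L v = card {i\<in>I. e i < v}" for v
  define K where "K v = card {i\<in>I. e i = v}" for v
  have LK: "card {i\<in>I. e i \<le> v} = L v + K v" for v
    unfolding L_def K_def using I
    by (subst card_Un_disjoint[symmetric]) (auto intro!: arg_cong[where f = card])
  have range_e: "{i\<in>I. e i \<in> e ` I \<and> Q i} = {i\<in>I. Q i}" for Q
    by auto
  have Kpos: "K v > 0" if "v \<in> e ` I" for v
    using that I unfolding K_def by (auto simp: card_gt_0_iff)
  have "(\<Sum>j\<in>I. clamp01 ((u * card I - L (e j)) / K (e j))) =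
      (\<Sum>v\<in>e ` I. \<Sum>j\<in>{j\<in>I. e j = v}. clamp01 ((u * card I - L (e j)) / K (e j)))"
    using I by (intro sum.image_gen) auto
  also have "\<dots> = (\<Sum>v\<in>e ` I. K v * clamp01 ((u * card I - L v) / K v))"
    by (simp add: K_def)
  also have "\<dots> = (\<Sum>v\<in>e ` I. h (L v + K v) - h (L v))"
  proof (intro sum.cong refl)
    fix v assume "v \<in> e ` I"
    then have "real (K v) > 0" using Kpos by auto
    then show "K v * clamp01 ((u * card I - L v) / K v) = h (L v + K v) - h (L v)"
      unfolding h_def by (auto simp: mult_clamp01_divide max_def min_def)
  qed
  also have "\<dots> = (\<Sum>v\<in>e ` I. h (card {i\<in>I. e i \<in> e ` I \<and> e i \<le> v}) - h (card {i\<in>I. e i \<in> e ` I \<and> e i < v}))"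
    unfolding range_e LK L_def ..
  also have "\<dots> = h (card {i\<in>I. e i \<in> e ` I}) - h 0"
    using I by (intro sum_rank_increments_telescope) auto
  also have "{i\<in>I. e i \<in> e ` I} = I" by auto
  also have "h (card I) - h 0 = card I * clamp01 u"
  proof -
    have "real (card I) > 0" using I by (auto simp: card_gt_0_iff)
    then show ?thesis
      using mult_clamp01_divide[of "card I" "u * card I"] unfolding h_def
      by (auto simp: max_def min_def)
  qed
  finally show ?thesis unfolding L_def K_def .
qed

section \<open>Measurability\<close>

lemma borel_measurable_randomized_step [measurable (raw)]:
  assumes [measurable]: "f \<in> borel_measurable M" "g \<in> borel_measurable M" "h \<in> borel_measurable M"
  shows "(\<lambda>x. randomized_step (f x) (g x) (h x)) \<in> borel_measurable M"
  unfolding randomized_step_def of_bool_def by measurable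

lemma measurable_score:
  assumes E: "split_conformity_measure m E" and "m \<le> n" "j \<in> {1..n + 1}"
  shows "(\<lambda>x. E (restrict x {1..m}) (x j)) \<in> borel_measurable (Pi\<^sub>M {1..n + 1} (\<lambda>_. borel))"
proof -
  have "(\<lambda>x. (restrict x {1..m}, x j)) \<in> Pi\<^sub>M {1..n + 1} (\<lambda>_. borel) \<rightarrow>\<^sub>M Pi\<^sub>M {1..m} (\<lambda>_. borel) \<Otimes>\<^sub>M borel"
    using assms by (intro measurable_Pair measurable_restrict_subset measurable_component_singleton) auto
  from measurable_compose[OF this E[unfolded split_conformity_measure_def]] show ?thesis
    by simp
qed

text \<open>A sorted atom is compared with \<open>y\<close> through the number of scores below, or
  at most, the test score. The counts are real sums of \<open>of_bool\<close> rather than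
  cardinalities, so that they are visibly measurable in the data.\<close>

lemma randomized_step_sorted_atom:
  fixes E :: "(nat \<Rightarrow> 'p::finite obs) \<Rightarrow> 'p obs \<Rightarrow> real" and x :: "real ^ 'p" and y :: real
  assumes E: "monotonic_conformity m E" "conformal_atoms_exist m n E"
    and z: "z \<in> extensional {1..n}" and i: "i \<in> {1..n - m}"
  defines "w \<equiv> restrict z {1..m}"
  defines "below \<equiv> (\<Sum>j = 1..n - m. of_bool (E w (z (m + j)) < E w (x, y)) :: real)"
    and "atmost \<equiv> (\<Sum>j = 1..n - m. of_bool (E w (z (m + j)) \<le> E w (x, y)) :: real)"
  shows "randomized_step t y (sorted_atom m n E z x i) =
    of_bool (real i \<le> below) + t * of_bool (real i \<le> atmost \<and> \<not> real i \<le> below)"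
proof -
  note C = conformal_atom_iff[OF E z, folded w_def]
  have "sorted_atom m n E z x i < y \<longleftrightarrow> real i \<le> below"
    unfolding below_def sum_of_bool_eq_card[OF finite_atLeastAtMost] of_nat_le_iff
    by (subst sorted_atom_iff[OF i, of "\<lambda>c. c < y"]) (auto simp: C cong: conj_cong)
  moreover have "sorted_atom m n E z x i \<le> y \<longleftrightarrow> real i \<le> atmost"
    unfolding atmost_def sum_of_bool_eq_card[OF finite_atLeastAtMost] of_nat_le_iff
    by (subst sorted_atom_iff[OF i, of "\<lambda>c. c \<le> y"]) (auto simp: C le_less cong: conj_cong)
  moreover have "sorted_atom m n E z x i = y \<longleftrightarrow>
      sorted_atom m n E z x i \<le> y \<and> \<not> sorted_atom m n E z x i < y"
    by auto
  ultimately show ?thesis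
    unfolding randomized_step_def by simp
qed

text \<open>The atoms are implicit solutions of equations, but they enter only through their
  position relative to the test response, hence through comparisons of measurable scores.\<close>

lemma borel_measurable_Q_cpd_tc:
  fixes E :: "(nat \<Rightarrow> 'p::finite obs) \<Rightarrow> 'p obs \<Rightarrow> real"
  assumes "m \<le> n" "split_conformity_measure m E"
    and E: "monotonic_conformity m E" "conformal_atoms_exist m n E"
  shows "(\<lambda>(x, t). Q_cpd_tc m n E (restrict x {1..n}) (x (n + 1)) t)
    \<in> borel_measurable (Pi\<^sub>M {1..n + 1} (\<lambda>_. borel) \<Otimes>\<^sub>M borel)"
proof -
  define s where "s j x = E (restrict x {1..m}) (x j)" for j and x :: "nat \<Rightarrow> 'p obs"
  have s: "s j \<in> borel_measurable (Pi\<^sub>M {1..n + 1} (\<lambda>_. borel))" if "j \<in> {1..n + 1}" for j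
    unfolding s_def using assms(1,2) that by (intro measurable_score) auto
  have [measurable]: "s (m + j) \<in> borel_measurable (Pi\<^sub>M {1..n + 1} (\<lambda>_. borel))" if "j \<in> {1..n - m}" for j
    using that by (intro s) auto
  have [measurable]: "s (n + 1) \<in> borel_measurable (Pi\<^sub>M {1..n + 1} (\<lambda>_. borel))"
    by (intro s) auto
  have restr: "restrict (restrict x {1..n}) {1..m} = restrict x {1..m}" for x :: "nat \<Rightarrow> 'p obs"
    using assms(1) by auto
  let ?wt = "\<lambda>i t. (if i = 1 then 1 + t else if i = n - m then 2 - t else 1) / real (n - m + 1)"
  let ?below = "\<lambda>x. \<Sum>j = 1..n - m. of_bool (s (m + j) x < s (n + 1) x) :: real"
    and ?atmost = "\<lambda>x. \<Sum>j = 1..n - m. of_bool (s (m + j) x \<le> s (n + 1) x) :: real"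
  let ?step = "\<lambda>i x t. of_bool (real i \<le> ?below x) + t * of_bool (real i \<le> ?atmost x \<and> \<not> real i \<le> ?below x)"
  have "(\<lambda>(x, t). Q_cpd_tc m n E (restrict x {1..n}) (x (n + 1)) t) =
      (\<lambda>(x, t). \<Sum>i = 1..n - m. max 0 (?wt i t) * ?step i x t)"
  proof (intro ext, clarify)
    fix x :: "nat \<Rightarrow> 'p obs" and t :: real
    obtain a b where ab: "x (n + 1) = (a, b)" by fastforce
    show "Q_cpd_tc m n E (restrict x {1..n}) (x (n + 1)) t =
        (\<Sum>i = 1..n - m. max 0 (?wt i t) * ?step i x t)"
      unfolding ab Q_cpd_tc_eq_sum
    proof (intro sum.cong refl arg_cong2[where f = times])
      fix i assume i: "i \<in> {1..n - m}"
      let ?z = "restrict x {1..n}" and ?e = "E (restrict x {1..m})"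
      have "(\<Sum>j = 1..n - m. of_bool (?e (?z (m + j)) < ?e (a, b))) = ?below x"
        "(\<Sum>j = 1..n - m. of_bool (?e (?z (m + j)) \<le> ?e (a, b))) = ?atmost x"
        unfolding s_def ab by (intro sum.cong refl; use assms(1) in auto)+
      then show "randomized_step t b (sorted_atom m n E ?z a i) = ?step i x t"
        using randomized_step_sorted_atom[OF E _ i, of ?z t b a]
        unfolding restr by simp
    qed
  qed
  also have "\<dots> \<in> borel_measurable (Pi\<^sub>M {1..n + 1} (\<lambda>_. borel) \<Otimes>\<^sub>M borel)"
    unfolding of_bool_def by measurable
  finally show ?thesis .
qed

section \<open>Exact uniformity of the split transducer\<close>

text \<open>The transducer in symmetric form, with the test index \<open>j\<close> counted among
  \<open>J\<close>: its tie with itself supplies the extra \<open>t\<close>, and any index can serve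
  as test point.\<close>

definition rank_transducer :: "'i set \<Rightarrow> ('i \<Rightarrow> real) \<Rightarrow> 'i \<Rightarrow> real \<Rightarrow> real" where
  "rank_transducer J e j t = (\<Sum>i\<in>J. randomized_step t (e j) (e i)) / card J"

lemma split_transducer_eq_rank_transducer:
  assumes "m \<le> n"
  shows "split_transducer m n E (restrict x {1..n}) (x (n + 1)) t =
    rank_transducer {m + 1..n + 1} (\<lambda>i. E (restrict x {1..m}) (x i)) (n + 1) t"
proof -
  define e where "e i = E (restrict x {1..m}) (x i)" for i
  have restr: "restrict (restrict x {1..n}) {1..m} = restrict x {1..m}"
    using assms by auto
  have card: "real (card {i\<in>{1..n - m}. P (restrict x {1..n} (m + i))}) = (\<Sum>i = m + 1..n. of_bool (P (x i)))" for P
  proof -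
    have "real (card {i\<in>{1..n - m}. P (restrict x {1..n} (m + i))}) =
        (\<Sum>i = 1..n - m. of_bool (P (restrict x {1..n} (m + i))))"
      by (simp add: sum.If_cases Int_def del: restrict_apply)
    also have "\<dots> = (\<Sum>i = m + 1..n. of_bool (P (x i)))"
      by (rule sum.reindex_bij_witness[of _ "\<lambda>i. i - m" "\<lambda>i. m + i"]) (use assms in auto)
    finally show ?thesis .
  qed
  have J: "{m + 1..n + 1} = insert (n + 1) {m + 1..n}"
    using assms by auto
  have "(\<Sum>i\<in>{m + 1..n + 1}. randomized_step t (e (n + 1)) (e i)) =
      (\<Sum>i = m + 1..n. of_bool (e i < e (n + 1))) + t * (\<Sum>i = m + 1..n. of_bool (e i = e (n + 1))) + t"
    unfolding J by (simp add: randomized_step_def sum.distrib sum_distrib_left del: sum_of_bool_eq sum_mult_of_bool_eq)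
  then show ?thesis
    unfolding split_transducer_def rank_transducer_def Let_def restr e_def
      card[of "\<lambda>a. E (restrict x {1..m}) a < E (restrict x {1..m}) (x (n + 1))"]
      card[of "\<lambda>a. E (restrict x {1..m}) a = E (restrict x {1..m}) (x (n + 1))"]
    using assms by (simp add: Suc_diff_le)
qed

lemma measure_uniform_01_atMost: "measure (uniform_measure lborel {0..1}) {..b} = clamp01 b"
proof -
  have "{0..1} \<inter> {..b} = {0..min 1 b}" for b :: real by auto
  then show ?thesis
    by (simp add: measure_uniform_measure clamp01_def max_def min_def)
qed

text \<open>The transducer is affine in \<open>t\<close>, with positive slope because
  \<open>j\<close> ties with itself, so the inequality can be solved for \<open>t\<close>. The
  threshold is the argument of \<open>clamp01\<close> in \<open>sum_clamp_ranks\<close>.\<close>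

lemma rank_transducer_le_iff:
  assumes "finite J" "j \<in> J"
  shows "rank_transducer J e j t \<le> u \<longleftrightarrow>
    t \<le> (u * card J - card {i\<in>J. e i < e j}) / card {i\<in>J. e i = e j}"
proof -
  have "card {i\<in>J. e i = e j} > 0" "card J > 0"
    using assms by (auto simp: card_gt_0_iff)
  moreover have "(\<Sum>i\<in>J. randomized_step t (e j) (e i)) = card {i\<in>J. e i < e j} + t * card {i\<in>J. e i = e j}"
    using assms(1) by (simp add: randomized_step_def sum.distrib Int_def flip: sum_distrib_left)
  ultimately show ?thesis
    unfolding rank_transducer_def by (simp add: field_simps)
qed

text \<open>\<open>S j\<close> exchanges the roles of \<open>j\<close> and \<open>k\<close> and
  preserves \<open>P\<close>, so the event has the same probability for every test index. The sum
  over all test indices is evaluated for fixed data by \<open>sum_clamp_ranks\<close>, and dividing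
  by \<open>card J\<close> gives the claim.\<close>

lemma rank_transducer_uniform:
  fixes e :: "'a \<Rightarrow> 'i \<Rightarrow> real" and u :: real
  assumes P: "prob_space P" and J: "finite J" "k \<in> J"
    and e [measurable]: "\<And>i. i \<in> J \<Longrightarrow> (\<lambda>x. e x i) \<in> borel_measurable P"
    and S [measurable]: "\<And>j. j \<in> J \<Longrightarrow> S j \<in> P \<rightarrow>\<^sub>M P"
    and inv: "\<And>j. j \<in> J \<Longrightarrow> distr P P (S j) = P"
    and perm: "\<And>j x i. j \<in> J \<Longrightarrow> x \<in> space P \<Longrightarrow> i \<in> J \<Longrightarrow> e (S j x) i = e x (Transposition.transpose j k i)"
  shows "measure (P \<Otimes>\<^sub>M uniform_measure lborel {0..1})
    {p\<in>space (P \<Otimes>\<^sub>M uniform_measure lborel {0..1}). rank_transducer J (e (fst p)) k (snd p) \<le> u} = clamp01 u"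
proof -
  let ?U = "uniform_measure lborel {0..1} :: real measure"
  interpret P: prob_space P by fact
  interpret U: prob_space ?U by (intro prob_space_uniform_measure) auto
  interpret PU: pair_prob_space P ?U ..
  have J_nonempty: "J \<noteq> {}" using J(2) by blast
  define A where "A j = {p\<in>space (P \<Otimes>\<^sub>M ?U). rank_transducer J (e (fst p)) j (snd p) \<le> u}" for j
  have A [measurable]: "A j \<in> sets (P \<Otimes>\<^sub>M ?U)" if "j \<in> J" for j
    unfolding A_def rank_transducer_def using that by measurable
  have "emeasure (P \<Otimes>\<^sub>M ?U) (A j) = emeasure (P \<Otimes>\<^sub>M ?U) (A k)" if j: "j \<in> J" for j
  proof -
    \<comment> \<open>For fixed \<open>t\<close>, the slice of \<open>A j\<close> is the preimage
      under \<open>S j\<close> of the slice of \<open>A k\<close>.\<close>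
    have "emeasure P ((\<lambda>x. (x, t)) -` A j) = emeasure P ((\<lambda>x. (x, t)) -` A k)" for t
    proof -
      have "rank_transducer J (e (S j x)) k t = rank_transducer J (e x) j t" if "x \<in> space P" for x
      proof -
        have "(\<Sum>i\<in>J. randomized_step t (e (S j x) k) (e (S j x) i)) =
            (\<Sum>i\<in>J. randomized_step t (e x j) (e x (Transposition.transpose j k i)))"
          using j J that by (intro sum.cong refl) (simp add: perm)
        also have "\<dots> = (\<Sum>i\<in>J. randomized_step t (e x j) (e x i))"
          using j J by (intro sum.reindex_bij_betw permutes_imp_bij permutes_swap_id)
        finally show ?thesis unfolding rank_transducer_def by simp
      qed
      then have "S j -` ((\<lambda>x. (x, t)) -` A k) \<inter> space P = (\<lambda>x. (x, t)) -` A j"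
        using measurable_space[OF S[OF j]] by (auto simp: A_def space_pair_measure)
      moreover have "(\<lambda>x. (x, t)) -` A k \<in> sets P"
        using A[OF J(2)] by (rule sets_Pair2)
      ultimately show ?thesis
        by (subst (2) inv[OF j, symmetric]) (simp add: emeasure_distr j)
    qed
    then show ?thesis
      unfolding PU.emeasure_pair_measure_alt2[OF A[OF j]] PU.emeasure_pair_measure_alt2[OF A[OF J(2)]]
      by simp
  qed
  then have "ennreal (card J * measure (P \<Otimes>\<^sub>M ?U) (A k)) = (\<Sum>j\<in>J. emeasure (P \<Otimes>\<^sub>M ?U) (A j))"
    by (simp add: PU.emeasure_eq_measure ennreal_mult ennreal_of_nat_eq_real_of_nat)
  \<comment> \<open>Fubini in the other order: the data are fixed and \<open>t\<close> is integrated
    first.\<close>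
  also have "\<dots> = (\<integral>\<^sup>+x. (\<Sum>j\<in>J. emeasure ?U (Pair x -` A j)) \<partial>P)"
    by (simp add: U.emeasure_pair_measure_alt[OF A] A nn_integral_sum U.measurable_emeasure_Pair)
  also have "\<dots> = (\<integral>\<^sup>+x. ennreal (card J * clamp01 u) \<partial>P)"
  proof (intro nn_integral_cong)
    fix x assume x: "x \<in> space P"
    have "emeasure ?U (Pair x -` A j) =
        ennreal (clamp01 ((u * card J - card {i\<in>J. e x i < e x j}) / card {i\<in>J. e x i = e x j}))"
      if "j \<in> J" for j
    proof -
      \<comment> \<open>The space of \<open>?U\<close> is the whole line, so the slice is a
        half-line; \<open>clamp01\<close> accounts for the restriction to [0, 1].\<close>
      have "Pair x -` A j = {..(u * card J - card {i\<in>J. e x i < e x j}) / card {i\<in>J. e x i = e x j}}"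
        using x that J by (auto simp: A_def space_pair_measure rank_transducer_le_iff)
      then show ?thesis by (simp add: U.emeasure_eq_measure measure_uniform_01_atMost)
    qed
    then have "(\<Sum>j\<in>J. emeasure ?U (Pair x -` A j)) = (\<Sum>j\<in>J.
        ennreal (clamp01 ((u * card J - card {i\<in>J. e x i < e x j}) / card {i\<in>J. e x i = e x j})))"
      by simp
    also have "\<dots> = ennreal (card J * clamp01 u)"
      using sum_clamp_ranks[OF J(1) J_nonempty, of u "e x"] by (subst sum_ennreal) (auto simp: clamp01_nonneg)
    finally show "(\<Sum>j\<in>J. emeasure ?U (Pair x -` A j)) = ennreal (card J * clamp01 u)" .
  qed
  also have "\<dots> = ennreal (card J * clamp01 u)"
    by (simp add: P.emeasure_space_1)
  finally have "card J * measure (P \<Otimes>\<^sub>M ?U) (A k) = card J * clamp01 u"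
    by (subst (asm) ennreal_inj) (auto simp: clamp01_def)
  moreover have "card J > 0" using J by (auto simp: card_gt_0_iff)
  ultimately show ?thesis unfolding A_def by simp
qed

lemma (in prob_space) distr_Pair_indep_set:
  assumes X: "X \<in> M \<rightarrow>\<^sub>M N1" and Y: "Y \<in> M \<rightarrow>\<^sub>M N2"
    and indep: "indep_set (sets (vimage_algebra (space M) X N1)) (sets (vimage_algebra (space M) Y N2))"
  shows "distr M (N1 \<Otimes>\<^sub>M N2) (\<lambda>\<omega>. (X \<omega>, Y \<omega>)) = distr M N1 X \<Otimes>\<^sub>M distr M N2 Y"
proof (rule sym, rule pair_measure_eqI)
  interpret X: prob_space "distr M N1 X" by (rule prob_space_distr) fact
  interpret Y: prob_space "distr M N2 Y" by (rule prob_space_distr) fact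
  show "sigma_finite_measure (distr M N1 X)" "sigma_finite_measure (distr M N2 Y)"
    by unfold_locales
  fix A B assume "A \<in> sets (distr M N1 X)" "B \<in> sets (distr M N2 Y)"
  then have AB: "A \<in> sets N1" "B \<in> sets N2" by auto
  have "emeasure (distr M (N1 \<Otimes>\<^sub>M N2) (\<lambda>\<omega>. (X \<omega>, Y \<omega>))) (A \<times> B) =
      emeasure M ((X -` A \<inter> space M) \<inter> (Y -` B \<inter> space M))"
    using X Y AB by (subst emeasure_distr) (auto intro!: arg_cong[where f = "emeasure M"])
  also have "\<dots> = ennreal (prob (X -` A \<inter> space M) * prob (Y -` B \<inter> space M))"
    using indep_setD[OF indep in_vimage_algebra[OF AB(1)] in_vimage_algebra[OF AB(2)]]
    by (simp add: emeasure_eq_measure)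
  also have "\<dots> = emeasure (distr M N1 X) A * emeasure (distr M N2 Y) B"
    using X Y AB by (simp add: emeasure_distr emeasure_eq_measure ennreal_mult)
  finally show "emeasure (distr M N1 X) A * emeasure (distr M N2 Y) B =
      emeasure (distr M (N1 \<Otimes>\<^sub>M N2) (\<lambda>\<omega>. (X \<omega>, Y \<omega>))) (A \<times> B)" ..
qed simp


text \<open>Turns the assumptions on the data into statements about the law of the tuple
  \<open>X\<close>: it forms a product law with \<open>\<tau>\<close> and is invariant under
  permuting coordinates.\<close>

lemma exchangeable_dataD:
  fixes Z :: "nat \<Rightarrow> 'a \<Rightarrow> 'p::finite obs"
  assumes "exchangeable_data n M Z \<tau>"
  defines "X \<equiv> \<lambda>\<omega>. \<lambda>i\<in>{1..n + 1}. Z i \<omega>" and "D \<equiv> Pi\<^sub>M {1..n + 1} (\<lambda>_. borel :: 'p obs measure)"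
  shows "prob_space M" "X \<in> M \<rightarrow>\<^sub>M D" "\<tau> \<in> borel_measurable M" "AE \<omega> in M. \<tau> \<omega> \<in> {0..1}"
    and "distr M (D \<Otimes>\<^sub>M borel) (\<lambda>\<omega>. (X \<omega>, \<tau> \<omega>)) = distr M D X \<Otimes>\<^sub>M uniform_measure lborel {0..1}"
    and "\<And>\<pi>. \<pi> permutes {1..n + 1} \<Longrightarrow>
      distr (distr M D X) (distr M D X) (\<lambda>x. \<lambda>i\<in>{1..n + 1}. x (\<pi> i)) = distr M D X"
proof -
  show M: "prob_space M" and \<tau>: "\<tau> \<in> borel_measurable M"
    using assms unfolding exchangeable_data_def by auto
  have U: "distr M borel \<tau> = uniform_measure lborel {0..1}"
    using assms unfolding exchangeable_data_def by auto
  have ex: "exchangeable M {1..n + 1} borel Z"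
    using assms unfolding exchangeable_data_def by auto
  show X: "X \<in> M \<rightarrow>\<^sub>M D"
    using ex unfolding X_def D_def exchangeable_def by (intro measurable_restrict) auto
  have "AE t in distr M borel \<tau>. t \<in> {0..1}"
    unfolding U by (intro AE_uniform_measureI) auto
  then show "AE \<omega> in M. \<tau> \<omega> \<in> {0..1}"
    by (rule AE_distrD[OF \<tau>])
  show "distr M (D \<Otimes>\<^sub>M borel) (\<lambda>\<omega>. (X \<omega>, \<tau> \<omega>)) = distr M D X \<Otimes>\<^sub>M uniform_measure lborel {0..1}"
    using prob_space.distr_Pair_indep_set[OF M X \<tau>] assms unfolding exchangeable_data_def U by auto
  fix \<pi> :: "nat \<Rightarrow> nat" assume \<pi>: "\<pi> permutes {1..n + 1}"
  have perm: "(\<lambda>x. \<lambda>i\<in>{1..n + 1}. x (\<pi> i)) \<in> D \<rightarrow>\<^sub>M D"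
    unfolding D_def using permutes_in_image[OF \<pi>]
    by (intro measurable_restrict measurable_component_singleton) auto
  have "distr (distr M D X) (distr M D X) (\<lambda>x. \<lambda>i\<in>{1..n + 1}. x (\<pi> i)) =
      distr (distr M D X) D (\<lambda>x. \<lambda>i\<in>{1..n + 1}. x (\<pi> i))"
    by (intro distr_cong) auto
  also have "\<dots> = distr M D ((\<lambda>x. \<lambda>i\<in>{1..n + 1}. x (\<pi> i)) \<circ> X)"
    by (rule distr_distr[OF perm X])
  also have "(\<lambda>x. \<lambda>i\<in>{1..n + 1}. x (\<pi> i)) \<circ> X = (\<lambda>\<omega>. \<lambda>i\<in>{1..n + 1}. Z (\<pi> i) \<omega>)"
    unfolding X_def comp_def using permutes_in_image[OF \<pi>] by (intro ext) (auto simp: restrict_def)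
  also have "distr M D \<dots> = distr M D X"
    using ex \<pi> unfolding exchangeable_def D_def X_def by blast
  finally show "distr (distr M D X) (distr M D X) (\<lambda>x. \<lambda>i\<in>{1..n + 1}. x (\<pi> i)) = distr M D X" .
qed

text \<open>\<open>rank_transducer_uniform\<close> is applied to the law of the data tuple, with
  \<open>J\<close> the calibration indices and the test index. Measurability of the event is
  recorded for the later comparison of probabilities.\<close>

lemma split_transducer_uniform:
  fixes E :: "(nat \<Rightarrow> 'p::finite obs) \<Rightarrow> 'p obs \<Rightarrow> real"
  assumes "m \<le> n" "split_conformity_measure m E"
    and data: "exchangeable_data n M Z \<tau>"
  shows "{\<omega>\<in>space M. eval_at_data (split_transducer m n E) n Z \<tau> \<omega> \<le> u} \<in> sets M"
    and "measure M {\<omega>\<in>space M. eval_at_data (split_transducer m n E) n Z \<tau> \<omega> \<le> u} = clamp01 u"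
proof -
  define X where "X = (\<lambda>\<omega>. \<lambda>i\<in>{1..n + 1}. Z i \<omega>)"
  define D where "D = Pi\<^sub>M {1..n + 1} (\<lambda>_. borel :: 'p obs measure)"
  let ?U = "uniform_measure lborel {0..1} :: real measure"
  note d = exchangeable_dataD[OF data, folded X_def D_def]
  interpret prob_space M by (rule d(1))
  note [measurable] = d(2,3)
  define J where "J = {m + 1..n + 1}"
  define e where "e x i = E (restrict x {1..m}) (x i)" for x :: "nat \<Rightarrow> 'p obs" and i
  define S where "S j x = (\<lambda>i\<in>{1..n + 1}. x (Transposition.transpose j (n + 1) i))" for j and x :: "nat \<Rightarrow> 'p obs"
  define P where "P = distr M D X"
  have sets_P [measurable_cong]: "sets P = sets D" unfolding P_def by simp
  have J: "finite J" "n + 1 \<in> J" "J \<subseteq> {1..n + 1}" using assms(1) unfolding J_def by auto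
  have e_D [measurable]: "(\<lambda>x. e x i) \<in> borel_measurable D" if "i \<in> J" for i
    unfolding e_def D_def using assms that J by (intro measurable_score) auto
  have tr: "Transposition.transpose j (n + 1) permutes {1..n + 1}" if "j \<in> J" for j
    using that J by (intro permutes_swap_id) auto
  define A where "A = {p\<in>space (P \<Otimes>\<^sub>M ?U). rank_transducer J (e (fst p)) (n + 1) (snd p) \<le> u}"
  have A: "A \<in> sets (P \<Otimes>\<^sub>M ?U)"
    unfolding A_def rank_transducer_def using J by measurable
  then have A': "A \<in> sets (D \<Otimes>\<^sub>M borel)"
    by (simp add: sets_P cong: sets_pair_measure_cong)
  have "measure (P \<Otimes>\<^sub>M ?U) A = clamp01 u"
    unfolding A_def
  proof (rule rank_transducer_uniform[where S = S])
    show "prob_space P" unfolding P_def by (rule prob_space_distr) measurable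
    show "(\<lambda>x. e x i) \<in> borel_measurable P" if "i \<in> J" for i
      using that by measurable
    fix j assume j: "j \<in> J"
    show "S j \<in> P \<rightarrow>\<^sub>M P"
      unfolding S_def measurable_cong_sets[OF sets_P sets_P] unfolding D_def
      using permutes_in_image[OF tr[OF j]]
      by (intro measurable_restrict measurable_component_singleton) auto
    show "distr P P (S j) = P"
      unfolding P_def S_def by (rule d(6)[OF tr[OF j]])
    fix x i assume i: "i \<in> J"
    \<comment> \<open>Both \<open>j\<close> and \<open>n + 1\<close> exceed \<open>m\<close>, so the
      swap leaves the training tuple, and with it the score function, unchanged.\<close>
    have "restrict (S j x) {1..m} = restrict x {1..m}"
      using j J assms(1) unfolding S_def J_def by (auto simp: Transposition.transpose_def restrict_def)
    then show "e (S j x) i = e x (Transposition.transpose j (n + 1) i)"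
      unfolding e_def using i J by (auto simp: S_def)
  qed (use J in auto)
  \<comment> \<open>Independence of \<open>\<tau>\<close> and the data enters here.\<close>
  moreover have "P \<Otimes>\<^sub>M ?U = distr M (D \<Otimes>\<^sub>M borel) (\<lambda>\<omega>. (X \<omega>, \<tau> \<omega>))"
    using d(5) unfolding P_def X_def by simp
  moreover have "{\<omega>\<in>space M. eval_at_data (split_transducer m n E) n Z \<tau> \<omega> \<le> u} =
      (\<lambda>\<omega>. (X \<omega>, \<tau> \<omega>)) -` A \<inter> space M"
  proof -
    have "eval_at_data (split_transducer m n E) n Z \<tau> \<omega> = rank_transducer J (e (X \<omega>)) (n + 1) (\<tau> \<omega>)" for \<omega>
    proof -
      have "(\<lambda>i\<in>{1..n}. Z i \<omega>) = restrict (X \<omega>) {1..n}" "Z (n + 1) \<omega> = X \<omega> (n + 1)"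
        unfolding X_def by (auto simp: restrict_def)
      then show ?thesis
        unfolding eval_at_data_def e_def J_def
        by (simp only: split_transducer_eq_rank_transducer[OF assms(1)])
    qed
    moreover have "(X \<omega>, \<tau> \<omega>) \<in> space (P \<Otimes>\<^sub>M ?U)" if "\<omega> \<in> space M" for \<omega>
      using measurable_space[OF d(2) that] by (simp add: space_pair_measure P_def)
    ultimately show ?thesis by (auto simp: A_def)
  qed
  ultimately show "measure M {\<omega>\<in>space M. eval_at_data (split_transducer m n E) n Z \<tau> \<omega> \<le> u} = clamp01 u"
    and "{\<omega>\<in>space M. eval_at_data (split_transducer m n E) n Z \<tau> \<omega> \<le> u} \<in> sets M"
    using A' by (auto simp: measure_distr)
qed

section \<open>Distance to the uniform distribution\<close>

lemma borel_measurable_eval_at_data_Q_cpd_tc: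
  fixes E :: "(nat \<Rightarrow> 'p::finite obs) \<Rightarrow> 'p obs \<Rightarrow> real"
  assumes "m \<le> n" "split_conformity_measure m E" "monotonic_conformity m E" "conformal_atoms_exist m n E"
    and data: "exchangeable_data n M Z \<tau>"
  shows "eval_at_data (Q_cpd_tc m n E) n Z \<tau> \<in> borel_measurable M"
proof -
  have "eval_at_data (Q_cpd_tc m n E) n Z \<tau> = (\<lambda>\<omega>. (\<lambda>(x, t). Q_cpd_tc m n E (restrict x {1..n}) (x (n + 1)) t)
      ((\<lambda>i\<in>{1..n + 1}. Z i \<omega>), \<tau> \<omega>))"
    unfolding eval_at_data_def
    by (auto simp: restrict_def fun_eq_iff intro!: arg_cong2[where f = "\<lambda>z z'. Q_cpd_tc m n E z z' _"])
  moreover have "\<dots> \<in> borel_measurable M"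
    using exchangeable_dataD(2,3)[OF data]
    by (intro measurable_compose[OF _ borel_measurable_Q_cpd_tc] measurable_Pair assms)
  ultimately show ?thesis by simp
qed

text \<open>Up to null sets, the event that the tail-corrected value is at most \<open>u\<close>
  lies between the events that the transducer is at most \<open>u - \<delta>\<close> and at most
  \<open>u + \<delta>\<close>, with \<open>\<delta>\<close> the bound. The distribution function
  \<open>clamp01\<close> of the transducer is 1-Lipschitz.\<close>

lemma Q_cpd_tc_approximately_uniform:
  fixes E :: "(nat \<Rightarrow> 'p::finite obs) \<Rightarrow> 'p obs \<Rightarrow> real"
  assumes N: "m + 2 \<le> n"
    and E: "split_conformity_measure m E" "monotonic_conformity m E" "conformal_atoms_exist m n E"
    and data: "exchangeable_data n M Z \<tau>"
  shows "\<bar>measure M {\<omega>\<in>space M. eval_at_data (Q_cpd_tc m n E) n Z \<tau> \<omega> \<le> u} - clamp01 u\<bar> \<le> 1 / real (n - m + 1)"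
proof -
  let ?Q = "eval_at_data (Q_cpd_tc m n E) n Z \<tau>" and ?T = "eval_at_data (split_transducer m n E) n Z \<tau>"
  define \<delta> where "\<delta> = 1 / real (n - m + 1)"
  have mn: "m \<le> n" using N by simp
  note d = exchangeable_dataD[OF data]
  interpret prob_space M by (rule d(1))
  note T = split_transducer_uniform[OF mn E(1) data]
  have [measurable]: "?Q \<in> borel_measurable M"
    using mn E data by (rule borel_measurable_eval_at_data_Q_cpd_tc)
  \<comment> \<open>\<open>\<tau>\<close> lies in [0, 1] only almost surely, so the pointwise bound
    becomes an almost sure one.\<close>
  have close: "AE \<omega> in M. \<bar>?Q \<omega> - ?T \<omega>\<bar> \<le> \<delta>"
    using d(4) unfolding eval_at_data_def \<delta>_def
    by eventually_elim (intro Q_cpd_tc_close_to_split_transducer N E; auto)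
  have "clamp01 (u - \<delta>) \<le> measure M {\<omega>\<in>space M. ?Q \<omega> \<le> u}"
    unfolding T(2)[symmetric] using close by (intro finite_measure_mono_AE) auto
  moreover have "measure M {\<omega>\<in>space M. ?Q \<omega> \<le> u} \<le> clamp01 (u + \<delta>)"
    unfolding T(2)[symmetric] using close by (intro finite_measure_mono_AE T(1)) auto
  moreover have "0 \<le> \<delta>" by (simp add: \<delta>_def)
  then have "clamp01 u - \<delta> \<le> clamp01 (u - \<delta>)" "clamp01 (u + \<delta>) \<le> clamp01 u + \<delta>"
    by (auto simp: clamp01_def max_def min_def)
  ultimately show ?thesis
    unfolding \<delta>_def[symmetric] by linarith
qed

theorem theorem4:
  fixes n0 :: nat and m :: "nat \<Rightarrow> nat"
    and E :: "nat \<Rightarrow> (nat \<Rightarrow> 'p::finite obs) \<Rightarrow> 'p obs \<Rightarrow> real"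
  assumes "\<And>n. n \<ge> n0 \<Longrightarrow> m n + 2 \<le> n"
    and "\<And>n. n \<ge> n0 \<Longrightarrow> split_conformity_measure (m n) (E n)"
    and "\<And>n. n \<ge> n0 \<Longrightarrow> monotonic_conformity (m n) (E n)"
    and "\<And>n. n \<ge> n0 \<Longrightarrow> balanced_conformity (m n) (E n)"
    and "\<And>n. n \<ge> n0 \<Longrightarrow> coercive_conformity (m n) (E n)"
    and "\<And>n. n \<ge> n0 \<Longrightarrow> conformal_atoms_exist (m n) n (E n)"
  shows "(filterlim (\<lambda>n. n - m n) at_top sequentially \<longrightarrow>
            asymptotic_rps n0
              (\<lambda>n (M :: 'a measure) Z. atoms_as_distinct (m n) n (E n) M Z)
              (\<lambda>n. Q_cpd_tc (m n) n (E n))) \<and>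
         (\<forall>n\<ge>n0. \<forall>(M :: 'a measure) Z \<tau>.
            exchangeable_data n M Z \<tau> \<and> atoms_as_distinct (m n) n (E n) M Z \<longrightarrow>
            (SUP u\<in>{0..1}.
               \<bar>\<P>(\<omega> in M. eval_at_data (Q_cpd_tc (m n) n (E n)) n Z \<tau> \<omega> \<le> u) - u\<bar>)
              \<le> 1 / real (n - m n + 1))"
proof (intro conjI impI allI)
  note approx = Q_cpd_tc_approximately_uniform[OF assms(1,2,3,6)]
  {
    fix n M Z \<tau> assume n: "n0 \<le> n"
      and "exchangeable_data n M Z \<tau> \<and> atoms_as_distinct (m n) n (E n) (M :: 'a measure) Z"
    then have data: "exchangeable_data n M Z \<tau>" by simp
    show "(SUP u\<in>{0..1}. \<bar>\<P>(\<omega> in M. eval_at_data (Q_cpd_tc (m n) n (E n)) n Z \<tau> \<omega> \<le> u) - u\<bar>)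
        \<le> 1 / real (n - m n + 1)"
    proof (rule cSUP_least)
      fix u :: real assume "u \<in> {0..1}"
      then have "clamp01 u = u" by (auto simp: clamp01_def)
      then show "\<bar>\<P>(\<omega> in M. eval_at_data (Q_cpd_tc (m n) n (E n)) n Z \<tau> \<omega> \<le> u) - u\<bar> \<le> 1 / real (n - m n + 1)"
        using approx[OF n n n n data, of u] by simp
    qed simp
  }
  assume lim: "filterlim (\<lambda>n. n - m n) at_top sequentially"
  \<comment> \<open>The limit has distribution function \<open>clamp01\<close>, and the bound holds
    for every real \<open>u\<close>, so the distribution functions converge at each point.\<close>
  have "weak_conv_m (\<lambda>n. distr (M n) borel (eval_at_data (Q_cpd_tc (m n) n (E n)) n (Z n) (\<tau> n)))
      (uniform_measure lborel {0..1})"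
    if data: "\<And>n. n0 \<le> n \<Longrightarrow> exchangeable_data n (M n) (Z n) (\<tau> n)"
    for M :: "nat \<Rightarrow> 'a measure" and Z \<tau>
    unfolding weak_conv_m_def weak_conv_def cdf_def2 measure_uniform_01_atMost
  proof (intro allI impI)
    fix u :: real
    let ?Q = "\<lambda>n. eval_at_data (Q_cpd_tc (m n) n (E n)) n (Z n) (\<tau> n)"
    let ?F = "\<lambda>n. measure (distr (M n) borel (?Q n)) {..u}"
    have "(\<lambda>n. 1 / real (n - m n + 1)) \<longlonglongrightarrow> 0"
      using filterlim_compose[OF LIMSEQ_inverse_real_of_nat lim] by (simp add: inverse_eq_divide)
    moreover have "eventually (\<lambda>n. norm (?F n - clamp01 u)
        \<le> 1 / real (n - m n + 1)) sequentially"
      using eventually_ge_at_top[of n0]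
    proof eventually_elim
      case (elim n)
      have "?Q n \<in> borel_measurable (M n)"
        using elim assms(1)[OF elim] by (intro borel_measurable_eval_at_data_Q_cpd_tc assms data) auto
      then have "?F n =
          measure (M n) {\<omega>\<in>space (M n). ?Q n \<omega> \<le> u}"
        by (subst measure_distr) (auto intro!: arg_cong[where f = "measure (M n)"])
      then show ?case
        using approx[OF elim elim elim elim data[OF elim], of u] by simp
    qed
    ultimately have "(\<lambda>n. ?F n - clamp01 u) \<longlonglongrightarrow> 0"
      by (rule Lim_null_comparison[rotated])
    then show "(\<lambda>n. ?F n) \<longlonglongrightarrow> clamp01 u"
      by (rule LIM_zero_cancel)
  qed
  then show "asymptotic_rps n0 (\<lambda>n (M :: 'a measure) Z. atoms_as_distinct (m n) n (E n) M Z) (\<lambda>n. Q_cpd_tc (m n) n (E n))"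
    unfolding asymptotic_rps_def
    using assms(1)
    by (intro conjI allI ballI impI Q_cpd_tc_bounds Q_cpd_tc_mono Q_cpd_tc_mono_tau
        Q_cpd_tc_at_bot Q_cpd_tc_at_top) simp_all
qed

end
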